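(* Let $n$ be a positive integer. For every abacus diagram on $2n$ columns, the corresponding lecture hall partition $\lambda=(\lambda_1,\ldots,\lambda_n)$ and the corresponding bounded partition $\boldsymbol{p}$ (both defined in the context) satisfy $|\lambda|=|\boldsymbol{p}|$, where $|\cdot|$ denotes the sum of the parts.
   Context: Fix a positive integer $n$. A lecture hall partition with $n$ parts is a sequence of non-negative integers $\lambda=(\lambda_1,\ldots,\lambda_n)$ (zero parts allowed) with $0\le \lambda_1/1\le\lambda_2/2\le\cdots\le\lambda_n/n$. A partition $\boldsymbol{p}$ (a finite multiset of positive integers) is bounded if all of its parts are at most $2n$ and its parts that are less than or equal to $n$ are distinct. The array. Consider an array with $2n$ columns indexed $1,\ldots,2n$ and rows indexed by $\mathbb{Z}$; the entry (position) in row $i$ and column $j$ is labeled by the integer $j+2ni$. Thus positions are identified with the integers, and column $j$ is the residue class of $j$ modulo $2n$. Reading order is the usual order on the integers. Column $j$ is dual to column $2n+1-j$ (so positions $p$ and $1-p$ lie in dual columns). Each position is designated either a bead or a gap. The first window is the set of positions $\{1,2,\ldots,n\}$. Abacus diagrams. A designation of all positions as beads or gaps is an abacus diagram (on $2n$ columns) if it is (1) flush: no bead in any column is preceded in reading order by a gap in the same column (that is, if $p$ is a bead then so is $p-2n$); and (2) balanced: for all $j\in\mathbb{Z}$, position $j$ is a bead if and only if position $1-j$ is a gap. The defining beads of an abacus diagram are the last (largest) $n$ beads, in reading order, among the set consisting of the lowest (largest) bead in each column; they are denoted $b_1<b_2<\cdots<b_n$. No two of them lie in the same column or in dual columns. Positions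 in the column containing $b_i$ or in its dual column are said to have class $i$. A position $p$ is $i$-active if $1\le p\le b_i$ and the class of $p$ is at most $i$. The corresponding lecture hall partition of an abacus diagram is $\lambda=(\lambda_1,\ldots,\lambda_n)$, where $\lambda_i$ is the number of $i$-active positions. The corresponding bounded partition $\boldsymbol{p}$ of an abacus diagram has exactly one part for each bead in a positive position: a bead at a position $b$ with $1\le b\le n$ contributes a part of size $b$, and a bead at a position $b>n$ contributes a part of size $1+\#\{\text{gaps at positions strictly between } b-2n \text{ and } b\}$. *)

theory Defs
  imports Complex_Main "HOL-Library.Multiset" "HOL-Number_Theory.Cong"
begin

text \<open>
  A designation of the integer positions as beads or gaps is represented by the set \<open>B\<close>
  of its beads; the gaps are the positions outside \<open>B\<close>. Columns are the residue classes
  modulo \<open>2n\<close>.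
\<close>

definition same_column :: "nat \<Rightarrow> int \<Rightarrow> int \<Rightarrow> bool" where
  "same_column n p q \<longleftrightarrow> [p = q] (mod (2 * int n))"

definition dual_column :: "nat \<Rightarrow> int \<Rightarrow> int \<Rightarrow> bool" where
  "dual_column n p q \<longleftrightarrow> same_column n p (1 - q)"

definition flush :: "nat \<Rightarrow> int set \<Rightarrow> bool" where
  "flush n B \<longleftrightarrow> (\<forall>p. p \<in> B \<longrightarrow> p - 2 * int n \<in> B)"

definition balanced :: "int set \<Rightarrow> bool" where
  "balanced B \<longleftrightarrow> (\<forall>j. j \<in> B \<longleftrightarrow> 1 - j \<notin> B)"

definition lowest_bead :: "nat \<Rightarrow> int set \<Rightarrow> int \<Rightarrow> bool" where
  "lowest_bead n B b \<longleftrightarrow> b \<in> B \<and> (\<forall>b'\<in>B. same_column n b' b \<longrightarrow> b' \<le> b)"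

text \<open>
  The last clause makes explicit what speaking of ``the lowest bead in each column''
  presupposes. It does not follow from the other two: a column consisting of beads only, with
  dual column consisting of gaps only, is flush and balanced (for \<open>n = 1\<close>, take the
  even integers as beads), but has no lowest bead and would give infinitely many parts.
\<close>

definition abacus_diagram :: "nat \<Rightarrow> int set \<Rightarrow> bool" where
  "abacus_diagram n B \<longleftrightarrow>
     flush n B \<and> balanced B \<and>
     (\<forall>j\<in>{1..2 * int n}. \<exists>b. same_column n b j \<and> lowest_bead n B b)"

definition defining_beads :: "nat \<Rightarrow> int set \<Rightarrow> int list" where
  "defining_beads n B =
     (let bs = sorted_list_of_set {b. lowest_bead n B b} in drop (length bs - n) bs)"

text \<open>The index \<open>i\<close> of \<open>b\<^sub>i\<close> ranges over \<open>1, \<dots>, n\<close>, whereas lists are indexed from \<open>0\<close>.\<close>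

definition defining_bead :: "nat \<Rightarrow> int set \<Rightarrow> nat \<Rightarrow> int" where
  "defining_bead n B i = defining_beads n B ! (i - 1)"

text \<open>
  No two defining beads lie in the same or in dual columns, so a position has exactly one class.
\<close>

definition has_class :: "nat \<Rightarrow> int set \<Rightarrow> int \<Rightarrow> nat \<Rightarrow> bool" where
  "has_class n B p i \<longleftrightarrow>
     i \<in> {1..n} \<and>
     (same_column n p (defining_bead n B i) \<or> dual_column n p (defining_bead n B i))"

definition active :: "nat \<Rightarrow> int set \<Rightarrow> nat \<Rightarrow> int \<Rightarrow> bool" where
  "active n B i p \<longleftrightarrow>
     1 \<le> p \<and> p \<le> defining_bead n B i \<and> (\<exists>k\<le>i. has_class n B p k)"

definition lecture_hall_partition_of :: "nat \<Rightarrow> int set \<Rightarrow> nat list" where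
  "lecture_hall_partition_of n B = map (\<lambda>i. card {p. active n B i p}) [1..<n + 1]"

definition bead_part :: "nat \<Rightarrow> int set \<Rightarrow> int \<Rightarrow> nat" where
  "bead_part n B b =
     (if b \<le> int n then nat b
      else 1 + card {g. g \<notin> B \<and> b - 2 * int n < g \<and> g < b})"

text \<open>
  An abacus diagram has only finitely many beads in positive positions, so \<^const>\<open>mset_set\<close> is
  never applied to an infinite set here.
\<close>

definition bounded_partition_of :: "nat \<Rightarrow> int set \<Rightarrow> nat multiset" where
  "bounded_partition_of n B = image_mset (bead_part n B) (mset_set {b \<in> B. 1 \<le> b})"

end

theory Submission imports Defs begin

text \<open>
  The columns of a class sum to \<open>1 - 2n\<close> in their lowest beads, so the defining beads are exactly the
  lowest beads \<open>\<ge> 1 - n\<close>. Every position has a unique class, and both sides split into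
  contributions of ordered pairs of defining beads. For \<open>\<lambda>\<close> the pair \<open>(x, c)\<close> with
  \<open>c \<le> x\<close> contributes the number of positions of the class of \<open>c\<close> in \<open>{1..x}\<close>. For
  the bounded partition, a bead \<open>b \<le> n\<close> has size \<open>b = #{1..b}\<close> and a bead \<open>b > n\<close> has size
  one plus a number of gaps, and both counts split by class; \<open>(x, c)\<close> collects the share
  of the class of \<open>c\<close> over all positive beads in the column of \<open>x\<close>. For \<open>c < x\<close> the contributions of
  \<open>(x, c)\<close> and \<open>(c, x)\<close> to the bounded partition together equal that of \<open>(x, c)\<close> to
  \<open>\<lambda>\<close>. Writing \<open>x = r + 2ns\<close> and \<open>c = u + 2nt\<close> with residues \<open>r, u\<close>
  in \<open>{1 - n..n}\<close>, so that exactly \<open>s\<close> beads of the column of \<open>x\<close> exceed \<open>n\<close>, both are equal to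
  \<open>2s + 1 - [r < u] - [r + u < 1]\<close>.
\<close>

section \<open>Counting the members of a residue class in an interval\<close>

text \<open>The members are \<open>a + m * k\<close>, and \<open>k \<le> z div m\<close> is
  equivalent to \<open>k * m \<le> z\<close>, so both bounds on \<open>p\<close> become bounds on
  \<open>k\<close>: what is counted is an interval of quotients.\<close>

lemma card_cong_interval:
  fixes m lo hi a :: int
  assumes "m > 0" "lo \<le> hi"
  shows "int (card {p. lo < p \<and> p \<le> hi \<and> [p = a] (mod m)}) = (hi - a) div m - (lo - a) div m"
proof -
  have "bij_betw (\<lambda>k. a + m * k) {(lo - a) div m <.. (hi - a) div m}
          {p. lo < p \<and> p \<le> hi \<and> [p = a] (mod m)}"
  proof (rule bij_betw_imageI)
    show "inj_on (\<lambda>k. a + m * k) {(lo - a) div m <.. (hi - a) div m}"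
      using assms by (auto simp: inj_on_def)
    have le_div: "k \<le> z div m \<longleftrightarrow> k * m \<le> z" for k z
    proof
      assume "k \<le> z div m"
      then have "k * m \<le> z div m * m" using assms by simp
      also have "\<dots> \<le> z" using assms by (simp add: minus_mod_eq_div_mult[symmetric])
      finally show "k * m \<le> z" .
    next
      assume "k * m \<le> z"
      then have "k * m div m \<le> z div m" using assms by (intro zdiv_mono1)
      then show "k \<le> z div m" using assms by simp
    qed
    have lo: "(lo - a) div m < k \<longleftrightarrow> lo < a + m * k" for k
      using le_div[of k "lo - a - 1"] le_div[of k "lo - a"]
        le_div[of "(lo - a) div m + 1" "lo - a"]
      by (auto simp: algebra_simps not_le[symmetric] simp del: not_le)
    have hi: "k \<le> (hi - a) div m \<longleftrightarrow> a + m * k \<le> hi" for k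
      using le_div[of k "hi - a"] by (auto simp: algebra_simps)
    have cong: "[p = a] (mod m) \<longleftrightarrow> (\<exists>k. p = a + m * k)" for p
      by (metis cong_iff_lin cong_sym)
    show "(\<lambda>k. a + m * k) ` {(lo - a) div m <.. (hi - a) div m}
            = {p. lo < p \<and> p \<le> hi \<and> [p = a] (mod m)}"
      by (auto simp: lo hi cong image_iff)
  qed
  then have "card {p. lo < p \<and> p \<le> hi \<and> [p = a] (mod m)} = card {(lo - a) div m <.. (hi - a) div m}"
    by (rule bij_betw_same_card[symmetric])
  moreover have "(lo - a) div m \<le> (hi - a) div m"
    using assms by (intro zdiv_mono1) auto
  ultimately show ?thesis by simp
qed

lemma finite_int_between: "finite {p::int. lo < p \<and> p \<le> hi \<and> P p}"
  by (rule finite_subset[of _ "{lo<..hi}"]) auto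

text \<open>Meant for \<open>z\<close> built from centered residues: it lies within one period of 0,
  so its sign settles the quotient and each \<open>div\<close> becomes a case distinction.\<close>

lemma div_shift:
  fixes m z k :: int
  assumes "m > 0" "- m \<le> z" "z < m"
  shows "(z + m * k) div m = (if z \<ge> 0 then k else k - 1)"
proof (cases "z \<ge> 0")
  case True
  then show ?thesis using assms by simp
next
  case False
  have "(z + m * k) div m = ((z + m) + m * (k - 1)) div m" by (simp add: algebra_simps)
  also have "\<dots> = (z + m) div m + (k - 1)"
    using assms by (subst div_mult_self2) auto
  also have "(z + m) div m = 0" using False assms by simp
  finally show ?thesis using False by simp
qed

section \<open>Classes of positions and centered residues\<close>

text \<open>A representative \<open>c\<close> replaces the index used in \<open>has_class\<close>,
  so that a bead may be traded for its residue.\<close>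

definition in_class :: "nat \<Rightarrow> int \<Rightarrow> int \<Rightarrow> bool" where
  "in_class n c p \<longleftrightarrow> [p = c] (mod (2 * int n)) \<or> [p = 1 - c] (mod (2 * int n))"

text \<open>Parity: \<open>c - (1 - c)\<close> is odd, whereas the modulus is even.\<close>

lemma not_self_dual: "\<not> ([p = c] (mod (2 * int n)) \<and> [p = 1 - c] (mod (2 * int n)))"
proof
  assume "[p = c] (mod (2 * int n)) \<and> [p = 1 - c] (mod (2 * int n))"
  then have "[c = 1 - c] (mod (2 * int n))" using cong_sym cong_trans by blast
  then have "2 * int n dvd c - (1 - c)" by (simp add: cong_iff_dvd_diff)
  then have "2 dvd c - (1 - c)" using dvd_mult_left by blast
  then show False by presburger
qed

lemma card_in_class_split:
  fixes lo hi :: int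
  shows "int (card {p. lo < p \<and> p \<le> hi \<and> in_class n c p \<and> P p})
    = int (card {p. lo < p \<and> p \<le> hi \<and> [p = c] (mod (2 * int n)) \<and> P p})
    + int (card {p. lo < p \<and> p \<le> hi \<and> [p = 1 - c] (mod (2 * int n)) \<and> P p})"
proof -
  have "{p. lo < p \<and> p \<le> hi \<and> in_class n c p \<and> P p}
    = {p. lo < p \<and> p \<le> hi \<and> [p = c] (mod (2 * int n)) \<and> P p}
    \<union> {p. lo < p \<and> p \<le> hi \<and> [p = 1 - c] (mod (2 * int n)) \<and> P p}"
    by (auto simp: in_class_def)
  then show ?thesis
    using not_self_dual[of _ c n]
    by (subst \<open>_ = _\<close>, subst card_Un_disjoint) (auto simp: finite_int_between)
qed

text \<open>The window \<open>1 - n..n\<close> is stable under \<open>r\<close> to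
  \<open>1 - r\<close>, so dual columns are treated alike; the bound on \<open>x\<close> makes the
  quotient a natural number.\<close>

lemma centered_decomposition:
  assumes "n \<ge> 1" "x \<ge> 1 - int n"
  obtains r :: int and s :: nat
  where "x = r + 2 * int n * int s" "1 - int n \<le> r" "r \<le> int n"
proof
  let ?z = "x + int n - 1"
  have nn: "?z div (2 * int n) \<ge> 0" using assms by (simp add: pos_imp_zdiv_nonneg_iff)
  show "x = (?z mod (2 * int n) + 1 - int n) + 2 * int n * int (nat (?z div (2 * int n)))"
    using nn mult_div_mod_eq[of "2 * int n" ?z] by (simp only: nat_0_le)
  show "1 - int n \<le> ?z mod (2 * int n) + 1 - int n" using assms by simp
  have "?z mod (2 * int n) < 2 * int n" using assms by simp
  then show "?z mod (2 * int n) + 1 - int n \<le> int n" by linarith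
qed

lemma centered_residues_distinct:
  fixes r u :: int and s t :: nat
  assumes "1 - int n \<le> r" "r \<le> int n" "1 - int n \<le> u" "u \<le> int n"
    and "\<not> in_class n (u + 2 * int n * int t) (r + 2 * int n * int s)"
  shows "r \<noteq> u" "r \<noteq> 1 - u"
proof -
  have "2 * int n dvd (r + 2 * int n * int s) - (r + 2 * int n * int t)"
    by (simp add: right_diff_distrib[symmetric])
  then show "r \<noteq> u" using assms(5) by (auto simp: in_class_def cong_iff_dvd_diff)
  have "2 * int n dvd (1 - u + 2 * int n * int s) - (1 - (u + 2 * int n * int t))"
    by (simp add: distrib_left[symmetric])
  then show "r \<noteq> 1 - u" using assms(5) by (auto simp: in_class_def cong_iff_dvd_diff)
qed

lemma cong_shift_iff:
  "[p = u + 2 * int n * int t] (mod (2 * int n)) \<longleftrightarrow> [p = u] (mod (2 * int n))"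
  "[p = 1 - (u + 2 * int n * int t)] (mod (2 * int n)) \<longleftrightarrow> [p = 1 - u] (mod (2 * int n))"
  by (auto simp: cong_def mod_diff_right_eq[symmetric, of 1 "u + _"] mod_diff_right_eq)

lemma in_class_shift: "in_class n (u + 2 * int n * int t) p \<longleftrightarrow> in_class n u p"
  by (simp add: in_class_def cong_shift_iff)

text \<open>Each of the columns of \<open>u\<close> and \<open>1 - u\<close> yields
  \<open>s\<close>, minus 1 if that residue exceeds \<open>r\<close>, plus 1 if it is positive.
  Exactly one of \<open>u\<close> and \<open>1 - u\<close> is positive, whence the constant
  1.\<close>

lemma card_in_class_initial:
  fixes r u :: int and s :: nat
  assumes n: "n \<ge> 1" and r: "1 - int n \<le> r" "r \<le> int n" and u: "1 - int n \<le> u" "u \<le> int n"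
    and pos: "0 \<le> r + 2 * int n * int s"
  shows "int (card {p. 0 < p \<and> p \<le> r + 2 * int n * int s \<and> in_class n u p})
    = 2 * int s + 1 - (if r < u then 1 else 0) - (if r + u < 1 then 1 else 0)"
proof -
  let ?m = "2 * int n"
  have m: "?m > 0" using n by simp
  have 1: "int (card {p. 0 < p \<and> p \<le> r + ?m * int s \<and> [p = u] (mod ?m)})
    = (if r < u then int s - 1 else int s) - (if u \<le> 0 then 0 else - 1)"
    using card_cong_interval[OF m pos, of u] div_shift[OF m, of "r - u" "int s"]
      div_shift[OF m, of "- u" 0] r u by (auto simp: algebra_simps)
  have 2: "int (card {p. 0 < p \<and> p \<le> r + ?m * int s \<and> [p = 1 - u] (mod ?m)})
    = (if r + u < 1 then int s - 1 else int s) - (if u \<ge> 1 then 0 else - 1)"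
    using card_cong_interval[OF m pos, of "1 - u"] div_shift[OF m, of "r + u - 1" "int s"]
      div_shift[OF m, of "u - 1" 0] r u by (auto simp: algebra_simps)
  show ?thesis
    using card_in_class_split[of 0 "r + ?m * int s" n u "\<lambda>_. True"] 1 2 by auto
qed

section \<open>Window counts of single beads\<close>

text \<open>When \<open>c\<close> is the defining bead of its class and \<open>b > n\<close>, this counts the gaps of that class
  strictly between \<open>b - 2n\<close> and \<open>b\<close>: every position above \<open>-n\<close> in the dual column is a gap.\<close>

definition window_count :: "nat \<Rightarrow> int \<Rightarrow> int \<Rightarrow> nat" where
  "window_count n c b =
     (if b \<le> int n then card {p. 0 < p \<and> p \<le> b \<and> in_class n c p}
      else card {g. b - 2 * int n < g \<and> g \<le> b - 1 \<and> in_class n c g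
                  \<and> \<not> ([g = c] (mod (2 * int n)) \<and> g \<le> c)})"

text \<open>If \<open>x\<close> is the lowest bead of its column in a flush \<open>B\<close>, these
  are the beads of that column in positive positions.\<close>

definition positive_beads :: "nat \<Rightarrow> int \<Rightarrow> int set" where
  "positive_beads n x = {b. 1 \<le> b \<and> b \<le> x \<and> [b = x] (mod (2 * int n))}"

lemma finite_positive_beads: "finite (positive_beads n x)"
  by (rule finite_subset[of _ "{1..x}"]) (auto simp: positive_beads_def)

text \<open>The bead with multiplier 0 is split off as the only one at most \<open>n\<close>, where
  \<open>window_count\<close> counts differently; it is positive only if
  \<open>r \<ge> 1\<close>.\<close>

lemma sum_positive_beads:
  fixes r :: int and s :: nat and f :: "int \<Rightarrow> 'a::comm_monoid_add"
  assumes n: "n \<ge> 1" and r: "1 - int n \<le> r" "r \<le> int n"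
  shows "sum f (positive_beads n (r + 2 * int n * int s))
    = (if r \<ge> 1 then f r else 0) + (\<Sum>j=1..s. f (r + 2 * int n * int j))"
proof -
  let ?h = "\<lambda>j::nat. r + 2 * int n * int j"
  have inj: "inj_on ?h A" for A using n by (auto simp: inj_on_def)
  have eq: "positive_beads n (?h s) = ?h ` {(if r \<ge> 1 then 0 else 1)..s}"
  proof (intro equalityI subsetI)
    fix b assume "b \<in> positive_beads n (?h s)"
    then have b: "1 \<le> b" "b \<le> ?h s" "[b = r] (mod (2 * int n))"
      by (auto simp: positive_beads_def cong_shift_iff)
    then obtain k where k: "b = r + 2 * int n * k" by (metis cong_iff_lin cong_sym)
    have "k \<ge> 0"
    proof (rule ccontr)
      assume "\<not> k \<ge> 0"
      then have "2 * int n * k \<le> 2 * int n * (-1)" using n by (intro mult_left_mono) auto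
      then show False using k b r by linarith
    qed
    then obtain j where j: "k = int j" using nonneg_int_cases by blast
    have "j \<le> s" using b(2) n unfolding k j by simp
    moreover have "j \<noteq> 0" if "\<not> r \<ge> 1" using b(1) that unfolding k j by (intro notI) simp
    ultimately show "b \<in> ?h ` {(if r \<ge> 1 then 0 else 1)..s}" unfolding k j by auto
  next
    fix b assume "b \<in> ?h ` {(if r \<ge> 1 then 0 else 1)..s}"
    then obtain j where j: "b = ?h j" "j \<le> s" "(if r \<ge> 1 then 0 else 1) \<le> j"
      by (meson atLeastAtMost_iff imageE)
    have "?h j \<le> ?h s" using j by (simp add: mult_left_mono)
    moreover have "1 \<le> ?h j"
    proof (cases "j = 0")
      case True
      then show ?thesis using j(3) by (auto split: if_splits)
    next
      case False
      then have "2 * int n * 1 \<le> 2 * int n * int j" by (intro mult_left_mono) auto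
      then show ?thesis using r n by linarith
    qed
    ultimately show "b \<in> positive_beads n (?h s)"
      using j by (auto simp: positive_beads_def cong_shift_iff cong_def)
  qed
  show ?thesis
  proof (cases "r \<ge> 1")
    case True
    then have "sum f (positive_beads n (?h s)) = (\<Sum>j=0..s. f (?h j))"
      using eq by (simp add: sum.reindex inj)
    then show ?thesis using True by (simp add: sum.atLeast_Suc_atMost)
  next
    case False
    then show ?thesis using eq by (simp add: sum.reindex inj)
  qed
qed

lemma window_count_small:
  assumes n: "n \<ge> 1" and r: "1 \<le> r" "r \<le> int n" and u: "1 - int n \<le> u" "u \<le> int n"
  shows "int (window_count n (u + 2 * int n * int t) r)
    = 1 - (if r < u then 1 else 0) - (if r + u < 1 then 1 else 0)"
  using card_in_class_initial[OF n _ _ u, of r 0] r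
  by (simp add: window_count_def in_class_shift)

text \<open>The open window from \<open>b - 2 * n\<close> to \<open>b\<close> meets every residue
  except that of \<open>b\<close> exactly once. The dual column thus gives the constant 1; the
  column of \<open>c\<close> gives 1 exactly when its member of the window lies beyond
  \<open>c\<close>.\<close>

lemma window_count_large:
  fixes r u :: int and j t :: nat
  assumes n: "n \<ge> 1" and r: "1 - int n \<le> r" "r \<le> int n" and u: "1 - int n \<le> u" "u \<le> int n"
    and j: "j \<ge> 1" and neq: "r \<noteq> 1 - u"
  shows "int (window_count n (u + 2 * int n * int t) (r + 2 * int n * int j))
    = 1 + (if t + (if r < u then 1 else 0) < j \<and> r \<noteq> u then 1 else 0)"
proof -
  let ?m = "2 * int n"
  let ?b = "r + ?m * int j" and ?c = "u + ?m * int t"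
  have m: "?m > 0" using n by simp
  have "?m * 1 \<le> ?m * int j" using j by (intro mult_left_mono) auto
  then have b: "\<not> ?b \<le> int n" using r n by linarith
  \<comment> \<open>The two conditions differ only at \<open>r + u = 1\<close>, which
    \<open>neq\<close> rules out; otherwise the value is 1.\<close>
  have dual: "int (card {g. ?b - ?m < g \<and> g \<le> ?b - 1 \<and> [g = 1 - u] (mod ?m)})
      = (if r + u - 2 \<ge> 0 then int j else int j - 1)
        - (if r + u - 1 \<ge> 0 then int j - 1 else int j - 1 - 1)"
    using card_cong_interval[OF m, of "?b - ?m" "?b - 1" "1 - u"] r u
      div_shift[OF m, of "r + u - 2" "int j"] div_shift[OF m, of "r + u - 1" "int j - 1"]
    by (auto simp: algebra_simps)
  have window: "int (card {g. ?b - ?m < g \<and> g \<le> ?b - 1 \<and> [g = u] (mod ?m)})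
      = (if r - u - 1 \<ge> 0 then int j else int j - 1)
        - (if r - u \<ge> 0 then int j - 1 else int j - 1 - 1)"
    using card_cong_interval[OF m, of "?b - ?m" "?b - 1" u] r u
      div_shift[OF m, of "r - u - 1" "int j"] div_shift[OF m, of "r - u" "int j - 1"]
    by (auto simp: algebra_simps)
  \<comment> \<open>For \<open>r \<noteq> u\<close> the member of the window is
    \<open>u + 2 * n * j\<close>, or one period lower if \<open>r < u\<close>; it exceeds
    \<open>?c\<close> iff \<open>?t' < j\<close>.\<close>
  let ?t' = "if r < u then t + 1 else t"
  have col: "int (card {g. ?b - ?m < g \<and> g \<le> ?b - 1 \<and> [g = u] (mod ?m) \<and> \<not> g \<le> ?c})
    = (if ?t' < j \<and> r \<noteq> u then 1 else 0)"
  proof (cases "?t' < j")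
    case True
    then have "?m * int ?t' \<le> ?m * (int j - 1)" by (intro mult_left_mono) auto
    then have "?c \<le> ?b - ?m" using r u by (auto simp: algebra_simps split: if_splits)
    then have "{g. ?b - ?m < g \<and> g \<le> ?b - 1 \<and> [g = u] (mod ?m) \<and> \<not> g \<le> ?c}
      = {g. ?b - ?m < g \<and> g \<le> ?b - 1 \<and> [g = u] (mod ?m)}" by auto
    then show ?thesis using window True by auto
  next
    case False
    \<comment> \<open>A member beyond \<open>?c\<close> has multiplier at least
      \<open>t + 1\<close>, which already places it above \<open>?b\<close>.\<close>
    have "g \<le> ?c" if g: "g \<le> ?b - 1" "[g = u] (mod ?m)" for g
    proof (rule ccontr)
      assume "\<not> g \<le> ?c"
      moreover obtain k where k: "g = u + ?m * k" using g(2) by (metis cong_iff_lin cong_sym)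
      ultimately have "?m * int t < ?m * k" by simp
      then have "int t < k" using m by simp
      show False
      proof (cases "r < u")
        case True
        then have "?m * int j \<le> ?m * k"
          using False \<open>int t < k\<close> by (intro mult_left_mono) auto
        then show ?thesis using g(1) True unfolding k by linarith
      next
        case ge: False
        then have "?m * (int j + 1) \<le> ?m * k"
          using False \<open>int t < k\<close> by (intro mult_left_mono) auto
        then show ?thesis using g(1) r u n unfolding k distrib_left by linarith
      qed
    qed
    then have empty: "{g. ?b - ?m < g \<and> g \<le> ?b - 1 \<and> [g = u] (mod ?m) \<and> \<not> g \<le> ?c} = {}"
      by auto
    show ?thesis unfolding empty using False by simp
  qed
  have "int (window_count n ?c ?b)
    = int (card {g. ?b - ?m < g \<and> g \<le> ?b - 1 \<and> in_class n u g \<and> \<not> ([g = u] (mod ?m) \<and> g \<le> ?c)})"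
    using b by (simp add: window_count_def in_class_shift cong_shift_iff)
  also have "\<dots> = int (card {g. ?b - ?m < g \<and> g \<le> ?b - 1 \<and> [g = u] (mod ?m)
                     \<and> \<not> ([g = u] (mod ?m) \<and> g \<le> ?c)})
    + int (card {g. ?b - ?m < g \<and> g \<le> ?b - 1 \<and> [g = 1 - u] (mod ?m)
                     \<and> \<not> ([g = u] (mod ?m) \<and> g \<le> ?c)})"
    by (rule card_in_class_split)
  also have "{g. ?b - ?m < g \<and> g \<le> ?b - 1 \<and> [g = u] (mod ?m) \<and> \<not> ([g = u] (mod ?m) \<and> g \<le> ?c)}
    = {g. ?b - ?m < g \<and> g \<le> ?b - 1 \<and> [g = u] (mod ?m) \<and> \<not> g \<le> ?c}" by auto
  also have "{g. ?b - ?m < g \<and> g \<le> ?b - 1 \<and> [g = 1 - u] (mod ?m) \<and> \<not> ([g = u] (mod ?m) \<and> g \<le> ?c)}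
    = {g. ?b - ?m < g \<and> g \<le> ?b - 1 \<and> [g = 1 - u] (mod ?m)}" using not_self_dual by blast
  finally show ?thesis using dual col neq by auto
qed


section \<open>Contributions of pairs of defining beads\<close>

text \<open>Through its beads above \<open>n\<close>, the column of \<open>x\<close> collects
  \<open>s\<close> from the dual column of \<open>y\<close> and \<open>s - t'\<close> from that of
  \<open>y\<close>, while the column of \<open>y\<close> collects only \<open>t\<close>. The beads
  at most \<open>n\<close> together add \<open>1 - [r + u < 1]\<close>, whatever the signs of
  \<open>r\<close> and \<open>u\<close>.\<close>

lemma sum_window_count_above:
  fixes x y :: int
  assumes n: "n \<ge> 1" and x: "x \<ge> 1 - int n" and y: "y \<ge> 1 - int n" and less: "y < x"
    and cls: "\<not> in_class n y x"
  shows "int (\<Sum>b\<in>positive_beads n x. window_count n y b)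
       + int (\<Sum>b\<in>positive_beads n y. window_count n x b)
       = int (card {p. 0 < p \<and> p \<le> x \<and> in_class n y p})"
proof -
  let ?m = "2 * int n"
  obtain r s where xr: "x = r + ?m * int s" and r: "1 - int n \<le> r" "r \<le> int n"
    using centered_decomposition[OF n x] .
  obtain u t where yu: "y = u + ?m * int t" and u: "1 - int n \<le> u" "u \<le> int n"
    using centered_decomposition[OF n y] .
  have neq: "r \<noteq> u" "r \<noteq> 1 - u" "u \<noteq> 1 - r"
    using centered_residues_distinct[OF r u] cls unfolding xr yu by auto
  \<comment> \<open>\<open>y < x\<close> compares quotients first and residues second, so
    \<open>r < u\<close> forces \<open>t < s\<close>.\<close>
  have ts: "t + (if r < u then 1 else 0) \<le> s"
  proof (rule ccontr)
    assume "\<not> ?thesis"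
    then have "?m * int s \<le> ?m * (int t + (if r < u then 1 else 0) - 1)"
      by (intro mult_left_mono) auto
    then show False using less r u neq unfolding xr yu by (auto simp: algebra_simps split: if_splits)
  qed
  define t' where "t' = t + (if r < u then 1 else 0)"
  have "(\<Sum>j=1..s. int (window_count n y (r + ?m * int j))) = (\<Sum>j=1..s. 1 + (if t' < j then 1 else 0))"
    unfolding yu by (rule sum.cong) (use window_count_large[OF n r u _ neq(2)] neq t'_def in auto)
  also have "\<dots> = int s + int (card ({1..s} \<inter> {j. t' < j}))"
    by (simp add: sum.distrib sum.If_cases)
  also have "{1..s} \<inter> {j. t' < j} = {t'<..s}" by auto
  finally have large_x: "(\<Sum>j=1..s. int (window_count n y (r + ?m * int j))) = 2 * int s - int t'"
    using ts by (simp add: t'_def)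
  \<comment> \<open>A second gap would need \<open>s < j \<le> t\<close>, contrary to
    \<open>t \<le> s\<close>.\<close>
  have "(\<Sum>j=1..t. int (window_count n x (u + ?m * int j))) = (\<Sum>j=1..t. 1)"
    unfolding xr by (rule sum.cong) (use window_count_large[OF n u r _ neq(3)] ts in auto)
  then have large_y: "(\<Sum>j=1..t. int (window_count n x (u + ?m * int j))) = int t" by simp
  have small_x: "int (window_count n y r) = 1 - (if r < u then 1 else 0) - (if r + u < 1 then 1 else 0)"
    if "r \<ge> 1" using window_count_small[OF n that r(2) u] unfolding yu .
  have small_y: "int (window_count n x u) = 1 - (if u < r then 1 else 0) - (if u + r < 1 then 1 else 0)"
    if "u \<ge> 1" using window_count_small[OF n that u(2) r] unfolding xr .
  have sum_x: "int (\<Sum>b\<in>positive_beads n x. window_count n y b)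
    = (if r \<ge> 1 then 1 - (if r < u then 1 else 0) - (if r + u < 1 then 1 else 0) else 0)
      + (2 * int s - int t')"
    using sum_positive_beads[OF n r, of "\<lambda>b. int (window_count n y b)" s] large_x small_x
    unfolding xr[symmetric] by auto
  have sum_y: "int (\<Sum>b\<in>positive_beads n y. window_count n x b)
    = (if u \<ge> 1 then 1 - (if u < r then 1 else 0) - (if u + r < 1 then 1 else 0) else 0) + int t"
    using sum_positive_beads[OF n u, of "\<lambda>b. int (window_count n x b)" t] large_y small_y
    unfolding yu[symmetric] by auto
  show ?thesis
  \<comment> \<open>The initial count requires an endpoint at least 0; for \<open>x < 0\<close> all
    three sets are empty.\<close>
  proof (cases "x \<ge> 0")
    case True
    have "int (card {p. 0 < p \<and> p \<le> x \<and> in_class n y p})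
      = 2 * int s + 1 - (if r < u then 1 else 0) - (if r + u < 1 then 1 else 0)"
      using card_in_class_initial[OF n r u, of s] True unfolding xr yu in_class_shift by simp
    then show ?thesis using sum_x sum_y neq unfolding t'_def by auto
  next
    case False
    then have "{p. 0 < p \<and> p \<le> x \<and> in_class n y p} = {}"
      "positive_beads n x = {}" "positive_beads n y = {}"
      using less by (auto simp: positive_beads_def)
    then show ?thesis by (simp only:) simp
  qed
qed

text \<open>Within its own class a bead above \<open>n\<close> sees one gap, in the dual column; the
  added constant of \<open>bead_part\<close> makes this 2. A bead at most \<open>n\<close> gives
  1.\<close>

lemma sum_window_count_own:
  fixes x :: int
  assumes n: "n \<ge> 1" and x: "x \<ge> 1 - int n"
  shows "(\<Sum>b\<in>positive_beads n x. window_count n x b + (if b \<le> int n then 0 else 1))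
       = card {p. 0 < p \<and> p \<le> x \<and> in_class n x p}"
proof -
  let ?m = "2 * int n"
  obtain r s where xr: "x = r + ?m * int s" and r: "1 - int n \<le> r" "r \<le> int n"
    using centered_decomposition[OF n x] .
  have neq: "r \<noteq> 1 - r" by presburger
  have gt: "\<not> r + ?m * int j \<le> int n" if "j \<ge> 1" for j
  proof -
    have "?m * 1 \<le> ?m * int j" using that by (intro mult_left_mono) auto
    then show ?thesis using r n by linarith
  qed
  let ?f = "\<lambda>b. int (window_count n x b) + (if b \<le> int n then 0 else 1)"
  have "?f (r + ?m * int j) = 2" if "j \<ge> 1" "j \<le> s" for j
  proof -
    have "int (window_count n x (r + ?m * int j)) = 1"
      using window_count_large[OF n r r that(1) neq, of s] unfolding xr by simp
    then show ?thesis using gt[OF that(1)] by presburger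
  qed
  then have "(\<Sum>j=1..s. ?f (r + ?m * int j)) = (\<Sum>j=1..s. 2)"
    by (intro sum.cong) (auto simp only: atLeastAtMost_iff)
  then have large: "(\<Sum>j=1..s. ?f (r + ?m * int j)) = 2 * int s" by simp
  have small: "?f r = 1" if "r \<ge> 1"
    using window_count_small[OF n that r(2) r, of s] that r unfolding xr by simp
  have sum: "(\<Sum>b\<in>positive_beads n x. ?f b) = (if r \<ge> 1 then 1 else 0) + 2 * int s"
    using sum_positive_beads[OF n r, of ?f s] large small unfolding xr[symmetric] by auto
  have "(\<Sum>b\<in>positive_beads n x. ?f b) = int (card {p. 0 < p \<and> p \<le> x \<and> in_class n x p})"
  proof (cases "x \<ge> 0")
    case True
    then show ?thesis
      using card_in_class_initial[OF n r r, of s] sum neq unfolding xr in_class_shift by auto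
  next
    case False
    then have "{p. 0 < p \<and> p \<le> x \<and> in_class n x p} = {}" "positive_beads n x = {}"
      by (auto simp: positive_beads_def)
    then show ?thesis by (simp only:) simp
  qed
  moreover have "(\<Sum>b\<in>positive_beads n x. ?f b)
    = int (\<Sum>b\<in>positive_beads n x. window_count n x b + (if b \<le> int n then 0 else 1))"
    unfolding of_nat_sum by (rule sum.cong) auto
  ultimately show ?thesis by (simp only: of_nat_eq_iff)
qed

section \<open>Columns and their lowest beads\<close>

lemma same_column_iff: "same_column n p q \<longleftrightarrow> 2 * int n dvd p - q"
  by (simp add: same_column_def cong_iff_dvd_diff)

lemma same_column_sym: "same_column n p q \<longleftrightarrow> same_column n q p"
  by (simp add: same_column_def cong_sym_eq)

lemma in_class_iff: "in_class n c p \<longleftrightarrow> same_column n p c \<or> dual_column n p c"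
  by (simp add: in_class_def same_column_def dual_column_def)

lemma flush_iterate:
  assumes "flush n B" "p \<in> B"
  shows "p - 2 * int n * int k \<in> B"
proof (induction k)
  case (Suc k)
  then have "p - 2 * int n * int k - 2 * int n \<in> B" using assms(1) by (simp add: flush_def)
  then show ?case by (simp add: algebra_simps)
qed (use assms in simp)

lemma flush_below:
  assumes "flush n B" "b \<in> B" "same_column n p b" "p \<le> b" "n \<ge> 1"
  shows "p \<in> B"
proof -
  have "2 * int n dvd b - p" using assms(3) by (simp only: same_column_iff dvd_diff_commute)
  then obtain k where k: "b - p = 2 * int n * k" by (auto elim: dvdE)
  have "k \<ge> 0"
  proof (rule ccontr)
    assume "\<not> k \<ge> 0"
    then have "2 * int n * k < 0" using assms(5) by (intro mult_pos_neg) auto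
    then show False using k assms(4) by linarith
  qed
  then obtain j where "k = int j" using nonneg_int_cases by blast
  then have "p = b - 2 * int n * int j" using k by simp
  then show ?thesis using flush_iterate[OF assms(1,2)] by simp
qed

lemma lowest_bead_mem_iff:
  assumes "flush n B" "n \<ge> 1" "lowest_bead n B b" "same_column n p b"
  shows "p \<in> B \<longleftrightarrow> p \<le> b"
  using assms flush_below unfolding lowest_bead_def by blast

lemma lowest_bead_unique:
  assumes "lowest_bead n B b" "lowest_bead n B c" "same_column n b c"
  shows "b = c"
proof (rule antisym)
  show "b \<le> c" using assms by (simp add: lowest_bead_def)
  show "c \<le> b" using assms same_column_sym[of n b c] by (simp add: lowest_bead_def)
qed

lemma lowest_bead_exists:
  assumes "abacus_diagram n B" "n \<ge> 1"
  obtains b where "lowest_bead n B b" "same_column n p b"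
proof -
  define j where "j = (p - 1) mod (2 * int n) + 1"
  have "j \<in> {1..2 * int n}" using assms(2) by (simp add: j_def add1_zle_eq)
  then obtain b where b: "same_column n b j" "lowest_bead n B b"
    using assms(1) unfolding abacus_diagram_def by blast
  have "[j = p] (mod (2 * int n))" unfolding j_def cong_def by (simp add: mod_add_left_eq)
  then have "same_column n p b" using b(1) unfolding same_column_def by (meson cong_sym cong_trans)
  then show ?thesis using that b by blast
qed

text \<open>Reflection \<open>q\<close> to \<open>1 - q\<close> exchanges beads and gaps: the first
  gap \<open>b + 2 * n\<close> of the column of \<open>b\<close> is sent to the last bead of the
  dual column.\<close>

lemma lowest_bead_dual:
  assumes "abacus_diagram n B" "n \<ge> 1" "lowest_bead n B b"
  shows "lowest_bead n B (1 - 2 * int n - b)"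
proof -
  have fl: "flush n B" and bal: "\<And>j. j \<in> B \<longleftrightarrow> 1 - j \<notin> B"
    using assms(1) unfolding abacus_diagram_def balanced_def by blast+
  have dual: "q \<in> B \<longleftrightarrow> b < 1 - q" if "same_column n q (1 - 2 * int n - b)" for q
  proof -
    have "2 * int n dvd q - (1 - 2 * int n - b)" using that by (simp add: same_column_iff)
    then have "2 * int n dvd 2 * int n - (q - (1 - 2 * int n - b))" by (rule dvd_diff[OF dvd_refl])
    then have "same_column n (1 - q) b" by (simp add: same_column_iff algebra_simps)
    then show ?thesis using bal[of q] lowest_bead_mem_iff[OF fl assms(2,3)] by auto
  qed
  \<comment> \<open>Anything later in this column is later by at least \<open>2 * n\<close>, so it
    reflects to a position at most \<open>b\<close>, which is a bead.\<close>
  have "q \<le> 1 - 2 * int n - b" if q: "q \<in> B" "same_column n q (1 - 2 * int n - b)" for q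
  proof (rule ccontr)
    assume c: "\<not> ?thesis"
    have "2 * int n dvd q - (1 - 2 * int n - b)" using q by (simp add: same_column_iff)
    then have "2 * int n \<le> q - (1 - 2 * int n - b)" using c by (intro zdvd_imp_le) auto
    then show False using dual[OF q(2)] q(1) by simp
  qed
  moreover have "1 - 2 * int n - b \<in> B"
    using dual[of "1 - 2 * int n - b"] assms(2) by (simp add: same_column_def)
  ultimately show ?thesis by (simp add: lowest_bead_def)
qed

section \<open>The defining beads and their classes\<close>

text \<open>The set of all \<open>b_i\<close>: dual lowest beads sum to the odd number
  \<open>1 - 2 * n\<close>, so exactly one of each dual pair is at least
  \<open>1 - n\<close>.\<close>

definition high_lowest_beads :: "nat \<Rightarrow> int set \<Rightarrow> int set" where
  "high_lowest_beads n B = {b. lowest_bead n B b \<and> b \<ge> 1 - int n}"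

lemma high_lowest_bead_class_exists:
  assumes "abacus_diagram n B" "n \<ge> 1"
  shows "\<exists>c\<in>high_lowest_beads n B. in_class n c p"
proof -
  obtain b where b: "lowest_bead n B b" "same_column n p b" using lowest_bead_exists[OF assms] .
  show ?thesis
  proof (cases "b \<ge> 1 - int n")
    case True
    then show ?thesis using b by (auto simp: high_lowest_beads_def in_class_iff)
  next
    case False
    have "2 * int n dvd (p - b) - 2 * int n"
      by (rule dvd_diff[OF _ dvd_refl]) (use b in \<open>simp add: same_column_iff\<close>)
    then have "dual_column n p (1 - 2 * int n - b)"
      by (simp add: dual_column_def same_column_iff algebra_simps)
    moreover have "1 - 2 * int n - b \<in> high_lowest_beads n B"
      using False lowest_bead_dual[OF assms b(1)] by (simp add: high_lowest_beads_def)
    ultimately show ?thesis by (auto simp: in_class_iff)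
  qed
qed

lemma high_lowest_bead_class_unique:
  assumes "abacus_diagram n B" "n \<ge> 1" "c \<in> high_lowest_beads n B" "d \<in> high_lowest_beads n B"
    and "in_class n c p" "in_class n d p"
  shows "c = d"
proof -
  \<comment> \<open>\<open>c\<close> and the reflection of \<open>d\<close> would be lowest beads of
    one column, hence equal, giving \<open>c + d = 1 - 2 * n\<close>; but
    \<open>c + d \<ge> 2 - 2 * n\<close>.\<close>
  have *: False if "c \<in> high_lowest_beads n B" "d \<in> high_lowest_beads n B"
    "same_column n p c" "dual_column n p d" for c d
  proof -
    have "2 * int n dvd (p - (1 - d)) - (p - c) + 2 * int n"
      using that(3,4) by (intro dvd_add[OF dvd_diff dvd_refl]) (simp_all only: same_column_iff dual_column_def)
    then have "same_column n c (1 - 2 * int n - d)" by (simp add: same_column_iff algebra_simps)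
    then have "c = 1 - 2 * int n - d"
      using that lowest_bead_dual[OF assms(1,2)]
      by (intro lowest_bead_unique[of n B]) (auto simp: high_lowest_beads_def)
    then show False using that by (simp add: high_lowest_beads_def)
  qed
  have "same_column n c d"
  proof -
    consider "same_column n p c" "same_column n p d" | "dual_column n p c" "dual_column n p d"
      using assms(5,6) * [OF assms(3,4)] * [OF assms(4,3)] by (auto simp: in_class_iff)
    then show ?thesis
    proof cases
      case 1
      then have "2 * int n dvd (p - d) - (p - c)" unfolding same_column_iff by (rule dvd_diff[rotated])
      then show ?thesis by (simp add: same_column_iff)
    next
      case 2
      then have "2 * int n dvd (p - (1 - c)) - (p - (1 - d))"
        unfolding same_column_iff dual_column_def by (rule dvd_diff)
      then show ?thesis by (simp add: same_column_iff)
    qed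
  qed
  then show ?thesis using assms by (intro lowest_bead_unique[of n B]) (auto simp: high_lowest_beads_def)
qed

lemma bij_betw_lowest_beads:
  assumes "abacus_diagram n B" "n \<ge> 1"
  shows "bij_betw (\<lambda>b. b mod (2 * int n)) {b. lowest_bead n B b} {0..<2 * int n}"
proof (rule bij_betw_imageI)
  show "inj_on (\<lambda>b. b mod (2 * int n)) {b. lowest_bead n B b}"
    by (auto simp: inj_on_def same_column_def cong_def intro: lowest_bead_unique[of n B])
  have "j \<in> (\<lambda>b. b mod (2 * int n)) ` {b. lowest_bead n B b}" if "j \<in> {0..<2 * int n}" for j
  proof -
    obtain b where "lowest_bead n B b" "same_column n j b" using lowest_bead_exists[OF assms] .
    then show ?thesis using that by (auto simp: same_column_def cong_def image_iff)
  qed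
  then show "(\<lambda>b. b mod (2 * int n)) ` {b. lowest_bead n B b} = {0..<2 * int n}"
    using assms(2) by auto
qed

text \<open>Reflection matches the low with the high lowest beads, so there are \<open>n\<close> of
  each, and dropping the first \<open>n\<close> of the sorted list leaves the high ones.\<close>

lemma defining_beads_eq:
  assumes "abacus_diagram n B" "n \<ge> 1"
  shows "defining_beads n B = sorted_list_of_set (high_lowest_beads n B)"
    and "finite (high_lowest_beads n B)" and "card (high_lowest_beads n B) = n"
proof -
  let ?S = "{b. lowest_bead n B b}" and ?D = "high_lowest_beads n B"
  let ?L = "{b. lowest_bead n B b \<and> b < 1 - int n}"
  have S: "finite ?S" "card ?S = 2 * n"
    using bij_betw_finite[OF bij_betw_lowest_beads[OF assms]]
      bij_betw_same_card[OF bij_betw_lowest_beads[OF assms]] by auto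
  have un: "?S = ?L \<union> ?D" "?L \<inter> ?D = {}" by (auto simp: high_lowest_beads_def)
  have fin: "finite ?L" "finite ?D" using S un(1) by (auto intro: finite_subset)
  have "(\<lambda>b. 1 - 2 * int n - b) ` ?D = ?L"
  proof (intro equalityI subsetI)
    fix b assume "b \<in> ?L"
    then show "b \<in> (\<lambda>b. 1 - 2 * int n - b) ` ?D"
      using lowest_bead_dual[OF assms, of b]
      by (intro image_eqI[of _ _ "1 - 2 * int n - b"]) (auto simp: high_lowest_beads_def)
  qed (use lowest_bead_dual[OF assms] assms(2) in \<open>auto simp: high_lowest_beads_def\<close>)
  moreover have "inj_on (\<lambda>b. 1 - 2 * int n - b) ?D" by (auto simp: inj_on_def)
  ultimately have "card ?L = card ?D" using card_image by metis
  moreover have "card ?S = card ?L + card ?D" using un fin by (simp add: card_Un_disjoint)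
  ultimately have card: "card ?L = n" "card ?D = n" using S(2) by auto
  have "sorted_list_of_set ?S = sorted_list_of_set ?L @ sorted_list_of_set ?D"
  proof (rule sorted_distinct_set_unique)
    show "sorted (sorted_list_of_set ?L @ sorted_list_of_set ?D)"
      using fin by (auto simp: sorted_append high_lowest_beads_def)
    show "distinct (sorted_list_of_set ?L @ sorted_list_of_set ?D)"
      using fin un(2) by auto
    show "set (sorted_list_of_set ?S) = set (sorted_list_of_set ?L @ sorted_list_of_set ?D)"
      using fin S un(1) by simp
  qed (use S in auto)
  then show "defining_beads n B = sorted_list_of_set ?D"
    by (simp add: defining_beads_def Let_def card)
  show "finite ?D" "card ?D = n" by fact+
qed

section \<open>Splitting both partitions by class\<close>

text \<open>Since the \<open>b_i\<close> increase strictly, \<open>k \<le> i\<close> on indices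
  becomes \<open>c \<le> x\<close> on beads; uniqueness of the class makes the sets for different
  \<open>c\<close> disjoint.\<close>

lemma sum_lecture_hall_partition:
  assumes "abacus_diagram n B" "n \<ge> 1"
  shows "sum_list (lecture_hall_partition_of n B)
    = (\<Sum>x\<in>high_lowest_beads n B. \<Sum>c\<in>{c\<in>high_lowest_beads n B. c \<le> x}.
        card {p. 0 < p \<and> p \<le> x \<and> in_class n c p})"
proof -
  let ?D = "high_lowest_beads n B"
  define xs where "xs = sorted_list_of_set ?D"
  note D = defining_beads_eq[OF assms]
  have xs: "set xs = ?D" "length xs = n" "distinct xs" "sorted_wrt (<) xs"
    using D unfolding xs_def by auto
  have bead: "defining_bead n B (Suc i) = xs ! i" for i
    by (simp add: defining_bead_def D(1) xs_def)
  have act: "card {p. active n B (Suc i) p}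
    = (\<Sum>c\<in>{c\<in>?D. c \<le> xs ! i}. card {p. 0 < p \<and> p \<le> xs ! i \<and> in_class n c p})"
    if i: "i < n" for i
  proof -
    have cls: "(\<exists>k\<le>Suc i. has_class n B p k) \<longleftrightarrow> (\<exists>c\<in>{c\<in>?D. c \<le> xs ! i}. in_class n c p)" for p
    proof
      assume "\<exists>k\<le>Suc i. has_class n B p k"
      then obtain k where k: "k \<le> Suc i" "k \<in> {1..n}" "has_class n B p k"
        by (auto simp: has_class_def)
      then obtain l where l: "k = Suc l" by (cases k) auto
      have "xs ! l \<le> xs ! i"
        using k l i xs by (intro sorted_nth_mono strict_sorted_imp_sorted) auto
      moreover have "xs ! l \<in> ?D" using k l xs by (metis Suc_le_lessD atLeastAtMost_iff nth_mem)
      ultimately show "\<exists>c\<in>{c\<in>?D. c \<le> xs ! i}. in_class n c p"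
        using k(3) bead[of l] unfolding l has_class_def in_class_iff by auto
    next
      assume "\<exists>c\<in>{c\<in>?D. c \<le> xs ! i}. in_class n c p"
      then obtain c where c: "c \<in> ?D" "c \<le> xs ! i" "in_class n c p" by auto
      then obtain l where l: "l < n" "c = xs ! l" using xs by (metis in_set_conv_nth)
      have "l \<le> i"
        using c(2) l xs i by (metis not_le sorted_wrt_nth_less)
      then show "\<exists>k\<le>Suc i. has_class n B p k"
        using c l bead[of l] by (intro exI[of _ "Suc l"]) (auto simp: has_class_def in_class_iff)
    qed
    have "{p. active n B (Suc i) p}
      = (\<Union>c\<in>{c\<in>?D. c \<le> xs ! i}. {p. 0 < p \<and> p \<le> xs ! i \<and> in_class n c p})"
      unfolding active_def bead cls by auto
    moreover have "card \<dots>
      = (\<Sum>c\<in>{c\<in>?D. c \<le> xs ! i}. card {p. 0 < p \<and> p \<le> xs ! i \<and> in_class n c p})"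
      using D(2) high_lowest_bead_class_unique[OF assms]
      by (intro card_UN_disjoint) (auto simp: finite_int_between)
    ultimately show ?thesis by simp
  qed
  have "sum_list (lecture_hall_partition_of n B) = (\<Sum>i=1..<n+1. card {p. active n B i p})"
    unfolding lecture_hall_partition_of_def by (simp add: interv_sum_list_conv_sum_set_nat)
  also have "\<dots> = (\<Sum>i<n. card {p. active n B (Suc i) p})"
    by (simp only: lessThan_atLeast0 One_nat_def add_Suc_right add_0_right sum.shift_bounds_Suc_ivl)
  also have "\<dots> = (\<Sum>i<n. (\<lambda>x. \<Sum>c\<in>{c\<in>?D. c \<le> x}. card {p. 0 < p \<and> p \<le> x \<and> in_class n c p}) (xs ! i))"
    by (rule sum.cong) (use act in auto)
  also have "\<dots> = (\<Sum>x\<in>?D. \<Sum>c\<in>{c\<in>?D. c \<le> x}. card {p. 0 < p \<and> p \<le> x \<and> in_class n c p})"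
    by (rule sum.reindex_bij_betw) (use xs bij_betw_nth in blast)
  finally show ?thesis .
qed

text \<open>The counted set, \<open>1..b\<close> or the gaps strictly between
  \<open>b - 2 * n\<close> and \<open>b\<close>, is partitioned by the classes of the defining
  beads.\<close>

lemma bead_part_eq:
  assumes "abacus_diagram n B" "n \<ge> 1" "1 \<le> b"
  shows "bead_part n B b
    = (\<Sum>c\<in>high_lowest_beads n B. window_count n c b) + (if b \<le> int n then 0 else 1)"
proof -
  let ?D = "high_lowest_beads n B"
  have fl: "flush n B" using assms(1) by (auto simp: abacus_diagram_def)
  note D = defining_beads_eq(2)[OF assms(1,2)]
  note ex = high_lowest_bead_class_exists[OF assms(1,2)]
  note unique = high_lowest_bead_class_unique[OF assms(1,2)]
  show ?thesis
  proof (cases "b \<le> int n")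
    case True
    have "(\<Sum>c\<in>?D. window_count n c b) = (\<Sum>c\<in>?D. card {p. 0 < p \<and> p \<le> b \<and> in_class n c p})"
      using True by (simp add: window_count_def)
    also have "\<dots> = card (\<Union>c\<in>?D. {p. 0 < p \<and> p \<le> b \<and> in_class n c p})"
      using D unique by (intro card_UN_disjoint[symmetric]) (auto simp: finite_int_between)
    also have "(\<Union>c\<in>?D. {p. 0 < p \<and> p \<le> b \<and> in_class n c p}) = {0<..b}"
      using ex by auto
    finally show ?thesis using True by (simp add: bead_part_def)
  next
    case False
    have gap: "g \<notin> B \<longleftrightarrow> \<not> ([g = c] (mod (2 * int n)) \<and> g \<le> c)"
      if "c \<in> ?D" "in_class n c g" "b - 2 * int n < g" for c g
    proof (cases "same_column n g c")
      case True
      then show ?thesis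
        using lowest_bead_mem_iff[OF fl assms(2) _ True] that
        by (auto simp: high_lowest_beads_def same_column_def)
    next
      case col: False
      then have dual: "same_column n g (1 - c)"
        using that(2) by (simp add: in_class_iff dual_column_def)
      have "lowest_bead n B (1 - 2 * int n - c)"
        using that(1) lowest_bead_dual[OF assms(1,2)] by (simp add: high_lowest_beads_def)
      moreover have "same_column n g (1 - 2 * int n - c)"
        using dvd_add[OF dual[unfolded same_column_iff] dvd_refl]
        by (simp add: same_column_iff algebra_simps)
      \<comment> \<open>\<open>b > n\<close> gives \<open>g > - n\<close>, while
        \<open>c \<ge> 1 - n\<close> puts the lowest bead of the dual column at \<open>- n\<close>
        or before.\<close>
      moreover have "\<not> g \<le> 1 - 2 * int n - c"
        using that(1,3) False by (simp add: high_lowest_beads_def)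
      ultimately have "g \<notin> B" using lowest_bead_mem_iff[OF fl assms(2)] by blast
      then show ?thesis using col by (simp add: same_column_def)
    qed
    let ?G = "\<lambda>c. {g. b - 2 * int n < g \<and> g \<le> b - 1 \<and> in_class n c g
                  \<and> \<not> ([g = c] (mod (2 * int n)) \<and> g \<le> c)}"
    have "(\<Sum>c\<in>?D. window_count n c b) = (\<Sum>c\<in>?D. card (?G c))"
      using False by (simp add: window_count_def)
    also have "\<dots> = card (\<Union>c\<in>?D. ?G c)"
      using D unique
      by (intro card_UN_disjoint[symmetric] ballI impI finite_int_between) auto
    also have "(\<Union>c\<in>?D. ?G c) = {g. g \<notin> B \<and> b - 2 * int n < g \<and> g < b}"
      using ex gap by (auto; force)
    finally show ?thesis using False by (simp add: bead_part_def)
  qed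
qed

text \<open>A positive bead bounds the lowest bead of its column from below, so that lowest bead is
  positive and hence a defining bead: no other columns contribute.\<close>

lemma sum_bounded_partition:
  assumes "abacus_diagram n B" "n \<ge> 1"
  shows "sum_mset (bounded_partition_of n B)
    = (\<Sum>x\<in>high_lowest_beads n B. \<Sum>b\<in>positive_beads n x.
        (\<Sum>c\<in>high_lowest_beads n B. window_count n c b) + (if b \<le> int n then 0 else 1))"
proof -
  let ?D = "high_lowest_beads n B"
  have fl: "flush n B" using assms(1) by (auto simp: abacus_diagram_def)
  note D = defining_beads_eq(2)[OF assms]
  have "{b\<in>B. 1 \<le> b} = (\<Union>x\<in>?D. positive_beads n x)"
  proof (intro equalityI subsetI)
    fix b assume b: "b \<in> {b\<in>B. 1 \<le> b}"
    obtain x where x: "lowest_bead n B x" "same_column n b x" using lowest_bead_exists[OF assms] .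
    then have "b \<le> x" using lowest_bead_mem_iff[OF fl assms(2)] b by blast
    then show "b \<in> (\<Union>x\<in>?D. positive_beads n x)"
      using b x by (auto simp: high_lowest_beads_def positive_beads_def same_column_def)
  next
    fix b assume "b \<in> (\<Union>x\<in>?D. positive_beads n x)"
    then show "b \<in> {b\<in>B. 1 \<le> b}"
      using lowest_bead_mem_iff[OF fl assms(2)]
      by (auto simp: high_lowest_beads_def positive_beads_def same_column_def)
  qed
  then have "sum_mset (bounded_partition_of n B) = sum (bead_part n B) (\<Union>x\<in>?D. positive_beads n x)"
    by (simp add: bounded_partition_of_def sum_unfold_sum_mset)
  also have "\<dots> = (\<Sum>x\<in>?D. \<Sum>b\<in>positive_beads n x. bead_part n B b)"
  proof (rule sum.UNION_disjoint)
    show "\<forall>x\<in>?D. \<forall>y\<in>?D. x \<noteq> y \<longrightarrow> positive_beads n x \<inter> positive_beads n y = {}"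
      using high_lowest_bead_class_unique[OF assms]
      by (auto simp: positive_beads_def in_class_def; blast)
  qed (use D finite_positive_beads in auto)
  also have "\<dots> = (\<Sum>x\<in>?D. \<Sum>b\<in>positive_beads n x.
        (\<Sum>c\<in>?D. window_count n c b) + (if b \<le> int n then 0 else 1))"
    by (intro sum.cong refl bead_part_eq[OF assms]) (auto simp: positive_beads_def)
  finally show ?thesis .
qed

section \<open>Symmetrization and comparison of the two sums\<close>

text \<open>Exchanging the order of summation transposes the pairs with \<open>x < c\<close>,
  folding the square onto a triangle.\<close>

lemma sum_pairs_symmetrize:
  fixes f :: "'a::linorder \<Rightarrow> 'a \<Rightarrow> 'b::comm_monoid_add"
  assumes "finite D"
  shows "(\<Sum>x\<in>D. \<Sum>c\<in>D. f x c) = (\<Sum>x\<in>D. f x x + (\<Sum>c\<in>{c\<in>D. c < x}. f x c + f c x))"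
proof -
  have split: "(\<Sum>c\<in>D. f x c) = f x x + ((\<Sum>c\<in>{c\<in>D. c < x}. f x c) + (\<Sum>c\<in>{c\<in>D. x < c}. f x c))"
    if "x \<in> D" for x
  proof -
    have "D = insert x ({c\<in>D. c < x} \<union> {c\<in>D. x < c})" using that by auto
    then have "(\<Sum>c\<in>D. f x c) = (\<Sum>c\<in>insert x ({c\<in>D. c < x} \<union> {c\<in>D. x < c}). f x c)" by simp
    also have "\<dots> = f x x + (\<Sum>c\<in>{c\<in>D. c < x} \<union> {c\<in>D. x < c}. f x c)"
      using assms by (intro sum.insert) auto
    also have "(\<Sum>c\<in>{c\<in>D. c < x} \<union> {c\<in>D. x < c}. f x c)
      = (\<Sum>c\<in>{c\<in>D. c < x}. f x c) + (\<Sum>c\<in>{c\<in>D. x < c}. f x c)"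
      using assms by (intro sum.union_disjoint) auto
    finally show ?thesis .
  qed
  have "(\<Sum>x\<in>D. \<Sum>c\<in>{c\<in>D. x < c}. f x c) = (\<Sum>x\<in>D. \<Sum>c\<in>{c\<in>D. c < x}. f c x)"
    using assms assms by (rule sum.swap_restrict)
  then show ?thesis using split by (simp add: sum.distrib)
qed

theorem theorem4p2:
  fixes n :: nat and B :: "int set"
  assumes "n \<ge> 1" and "abacus_diagram n B"
  shows "sum_list (lecture_hall_partition_of n B) = sum_mset (bounded_partition_of n B)"
proof -
  let ?D = "high_lowest_beads n B"
  let ?L = "\<lambda>x c. card {p. 0 < p \<and> p \<le> x \<and> in_class n c p}"
  let ?e = "\<lambda>b. if b \<le> int n then 0 else (1::nat)"
  \<comment> \<open>The extra 1 of a bead above \<open>n\<close> is charged to the diagonal pair, so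
    that the bounded partition becomes one sum over ordered pairs.\<close>
  let ?R = "\<lambda>x c. (\<Sum>b\<in>positive_beads n x. window_count n c b + (if c = x then ?e b else 0))"
  note D = defining_beads_eq(2)[OF assms(2,1)]
  have low: "x \<ge> 1 - int n" if "x \<in> ?D" for x using that by (simp add: high_lowest_beads_def)
  have "sum_mset (bounded_partition_of n B) = (\<Sum>x\<in>?D. \<Sum>c\<in>?D. ?R x c)"
    unfolding sum_bounded_partition[OF assms(2,1)]
  proof (rule sum.cong[OF refl])
    fix x assume x: "x \<in> ?D"
    have "(\<Sum>c\<in>?D. window_count n c b) + ?e b
      = (\<Sum>c\<in>?D. window_count n c b + (if c = x then ?e b else 0))" for b
      using x D by (simp only: sum.distrib sum.delta if_True)
    then show "(\<Sum>b\<in>positive_beads n x. (\<Sum>c\<in>?D. window_count n c b) + ?e b) = (\<Sum>c\<in>?D. ?R x c)"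
      by (simp only:) (rule sum.swap)
  qed
  also have "\<dots> = (\<Sum>x\<in>?D. ?R x x + (\<Sum>c\<in>{c\<in>?D. c < x}. ?R x c + ?R c x))"
    by (rule sum_pairs_symmetrize[OF D])
  also have "\<dots> = (\<Sum>x\<in>?D. ?L x x + (\<Sum>c\<in>{c\<in>?D. c < x}. ?L x c))"
  proof (intro sum.cong refl arg_cong2[where f = "(+)"])
    fix x assume x: "x \<in> ?D"
    show "?R x x = ?L x x" using sum_window_count_own[OF assms(1) low[OF x]] by simp
    fix c assume "c \<in> {c\<in>?D. c < x}"
    then have c: "c \<in> ?D" "c < x" by auto
    then have "\<not> in_class n c x"
      using high_lowest_bead_class_unique[OF assms(2,1) c(1) x, of x]
      by (auto simp: in_class_def)
    then have "int (?R x c) + int (?R c x) = int (?L x c)"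
      using sum_window_count_above[OF assms(1) low[OF x] low[OF c(1)] c(2)] c(2) by simp
    then show "?R x c + ?R c x = ?L x c" by linarith
  qed
  also have "\<dots> = (\<Sum>x\<in>?D. \<Sum>c\<in>{c\<in>?D. c \<le> x}. ?L x c)"
  proof (rule sum.cong[OF refl])
    fix x assume x: "x \<in> ?D"
    have "{c\<in>?D. c \<le> x} = insert x {c\<in>?D. c < x}" using x by auto
    then show "?L x x + (\<Sum>c\<in>{c\<in>?D. c < x}. ?L x c) = (\<Sum>c\<in>{c\<in>?D. c \<le> x}. ?L x c)"
      using D by simp
  qed
  finally show ?thesis using sum_lecture_hall_partition[OF assms(2,1)] by simp
qed

end
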